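(* For $k\ge1$, $$\nu_2(d_{2k}^{\pm})=-\bigl(5k+\nu_2(k!)\bigr),$$ and for $k\ge0$, $$\nu_2(d_{2k+1}^{\pm})=-\bigl(5k+2+\nu_2(k!)\bigr),$$ for both choices of sign, i.e. for the coefficients of both $\operatorname{Den}$ and $\operatorname{Den}^{-1}$.
   Context: For $k\ge0$ let $a_k(0)=\dfrac{\prod_{j=0}^{k-1}(-(2j+1)^2)}{8^k k!}$, let $p=1+i$, $q=1-i$, $G_n=\sum_{l=0}^n a_l(0)a_{n-l}(0)p^lq^{n-l}$, and let $$\operatorname{Den}=F(0,0;Z)=\sum_{n\ge0}\frac{G_n}{(Z-1)(Z-2)\cdots(Z-n)},$$ a formal power series in $v=1/Z$ (each summand expanded at $Z=\infty$) with constant term $1$ and rational coefficients. Write $\Lambda(v)=\log\operatorname{Den}=\sum_{n\ge1}\lambda_nv^n$; explicitly $\lambda_n=\dfrac{4^n}{n(n+1)}\bigl[2B_{n+1}(\frac34)-B_{n+1}(1)-B_{n+1}(\frac12)\bigr]$ with $B_k(x)$ the Bernoulli polynomials. The numbers $d_n^{\pm}$ are defined by $\operatorname{Den}^{\pm1}=\exp(\pm\Lambda)=\sum_{n\ge0}d_n^{\pm}v^n$. $\nu_2$ is the $2$-adic valuation on $\mathbb Q$. *)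

theory Defs
  imports Complex_Main "HOL-Computational_Algebra.Computational_Algebra"
begin

definition a0 :: "nat \<Rightarrow> complex" where
  "a0 k = (\<Prod>j<k. - ((2 * of_nat j + 1) ^ 2)) / (8 ^ k * fact k)"

definition G :: "nat \<Rightarrow> complex" where
  "G n = (\<Sum>l\<le>n. a0 l * a0 (n - l) * (1 + \<i>) ^ l * (1 - \<i>) ^ (n - l))"

text \<open>
  The formal variable is \<open>v = 1/Z\<close>, so that \<open>1/(Z - j)\<close>, expanded at \<open>Z = \<infinity>\<close>, is
  \<open>v/(1 - j v)\<close>. The coefficients of all series below are rational, but they are
  complex numbers by type, since \<open>G\<close> is defined through \<open>1 + \<i>\<close> and \<open>1 - \<i>\<close>.
\<close>

definition Den_term :: "nat \<Rightarrow> complex fps" where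
  "Den_term n = fps_const (G n) * (\<Prod>j=1..n. fps_X / (1 - of_nat j * fps_X))"

text \<open>The sum is taken in the \<open>v\<close>-adic topology; it converges by \<open>Den_sums\<close> below.\<close>

definition Den :: "complex fps" where
  "Den = (\<Sum>n. Den_term n)"

definition log_Den :: "complex fps" where
  "log_Den = fps_ln 1 oo (Den - 1)"

text \<open>
  For \<open>s = 1\<close> and \<open>s = -1\<close> these are the numbers \<open>d\<^sub>n\<^sup>+\<close> and \<open>d\<^sub>n\<^sup>-\<close>; that they are also
  the coefficients of \<open>exp (\<plusminus>\<Lambda>)\<close> with \<open>\<Lambda> = log Den\<close> is \<open>d_eq_exp_log\<close> below.
\<close>

definition d :: "int \<Rightarrow> nat \<Rightarrow> complex" where
  "d s n = fps_nth (Den powi s) n"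

text \<open>
  The 2-adic valuation on the rationals. The value at 0 (mathematically \<open>\<infinity>\<close>) is 0 here,
  so an equation \<open>\<nu>\<^sub>2 x = m\<close> with \<open>m < 0\<close> entails \<open>x \<noteq> 0\<close>.
\<close>

definition \<nu>\<^sub>2 :: "rat \<Rightarrow> int" where
  "\<nu>\<^sub>2 x = int (multiplicity 2 (fst (quotient_of x))) - int (multiplicity 2 (snd (quotient_of x)))"

lemma Den_term_nth_eq_0: "m < n \<Longrightarrow> fps_nth (Den_term n) m = 0"
proof -
  assume mn: "m < n"
  have "(\<Prod>j=1..n. fps_X / (1 - of_nat j * fps_X :: complex fps)) =
        (\<Prod>j=1..n. fps_X * inverse (1 - of_nat j * fps_X))"
    by (intro prod.cong refl) (simp add: fps_divide_unit)
  also have "\<dots> = fps_X ^ n * (\<Prod>j=1..n. inverse (1 - of_nat j * fps_X))"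
    by (simp add: prod.distrib)
  finally have "Den_term n =
      fps_X ^ n * (fps_const (G n) * (\<Prod>j=1..n. inverse (1 - of_nat j * fps_X)))"
    unfolding Den_term_def by (simp only: mult.left_commute)
  then show ?thesis
    using mn by (simp add: fps_X_power_mult_nth)
qed

lemma Den_sums: "Den_term sums Den"
proof -
  let ?L = "Abs_fps (\<lambda>m. \<Sum>n\<le>m. fps_nth (Den_term n) m)"
  have "Den_term sums ?L"
    unfolding sums_def
  proof (rule tendsto_fpsI)
    fix m
    have "fps_nth (sum Den_term {..<N}) m = fps_nth ?L m" if "N > m" for N
    proof -
      have "(\<Sum>n<N. fps_nth (Den_term n) m) = (\<Sum>n\<le>m. fps_nth (Den_term n) m)"
        using that by (intro sum.mono_neutral_right) (auto simp: Den_term_nth_eq_0)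
      then show ?thesis by (simp add: fps_sum_nth)
    qed
    then show "\<forall>\<^sub>F N in sequentially. fps_nth (sum Den_term {..<N}) m = fps_nth ?L m"
      by (rule eventually_mono[OF eventually_gt_at_top[of m]])
  qed
  then show ?thesis
    unfolding Den_def by (metis sums_unique)
qed

lemma Den_nth: "fps_nth Den m = (\<Sum>n\<le>m. fps_nth (Den_term n) m)"
proof -
  have "(\<lambda>N. sum Den_term {..<N}) \<longlonglongrightarrow> Den"
    using Den_sums by (simp add: sums_def)
  then have "\<forall>\<^sub>F N in sequentially. fps_nth (sum Den_term {..<N}) m = fps_nth Den m"
    by (simp add: tendsto_fps_iff)
  then obtain N where N: "\<And>M. M \<ge> N \<Longrightarrow> fps_nth (sum Den_term {..<M}) m = fps_nth Den m"
    by (auto simp: eventually_sequentially)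
  have "fps_nth Den m = (\<Sum>n<max N (Suc m). fps_nth (Den_term n) m)"
    using N[of "max N (Suc m)"] by (simp add: fps_sum_nth)
  also have "\<dots> = (\<Sum>n\<le>m. fps_nth (Den_term n) m)"
    by (intro sum.mono_neutral_right) (auto simp: Den_term_nth_eq_0)
  finally show ?thesis .
qed

lemma Den_nth_0: "fps_nth Den 0 = 1"
  by (simp add: Den_nth Den_term_def G_def a0_def)

lemma exp_log_Den: "fps_exp 1 oo log_Den = Den"
proof -
  have D0: "fps_nth (Den - 1) 0 = 0" by (simp add: Den_nth_0)
  have inv: "(fps_exp 1 - 1) oo fps_ln 1 = (fps_X :: complex fps)"
    by (simp add: fps_ln_fps_exp_inv fps_inv_right)
  have "fps_exp 1 oo fps_ln 1 = (1 + fps_X :: complex fps)"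
    using inv by (simp add: fps_compose_sub_distrib algebra_simps)
  then have "(1 + fps_X) oo (Den - 1) = fps_exp 1 oo log_Den"
    unfolding log_Den_def using fps_compose_assoc[OF D0, of "fps_ln 1" "fps_exp 1"] by simp
  moreover have "(1 + fps_X) oo (Den - 1) = Den"
    by (simp only: fps_compose_add_distrib fps_X_fps_compose_startby0[OF D0] fps_compose_1) simp
  ultimately show ?thesis by simp
qed

lemma d_eq_exp_log:
  assumes "s \<in> {1, -1}"
  shows "d s n = fps_nth (fps_exp (of_int s) oo log_Den) n"
proof -
  have "log_Den $ 0 = 0" by (simp add: log_Den_def)
  then have "fps_exp (-1) oo log_Den = inverse Den"
    using fps_inverse_compose[of log_Den "fps_exp 1"] by (simp add: fps_exp_neg exp_log_Den)
  then show ?thesis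
    using assms by (auto simp: d_def exp_log_Den power_int_def)
qed

end

theory Submission
  imports Defs
begin

text \<open>
  The claimed valuation of the \<open>n\<close>-th coefficient, for \<open>n = 2k\<close> as for \<open>n = 2k + 1\<close>, is that of
  \<open>1/(4\<^sup>n n!)\<close>: the factorial contributes \<open>\<nu>\<^sub>2(n!) = k + \<nu>\<^sub>2(k!)\<close>. So the statement says that
  \<open>4\<^sup>n n! d\<^sub>n\<close> is a quotient of two odd integers. In other words, as exponential generating
  functions in \<open>v/4\<close>, both \<open>Den\<close> and its inverse are congruent to \<open>exp (v/4)\<close> modulo 2.

  This is a property of the logarithmic derivative \<open>Den'/Den = \<Sum> m\<^sub>n v\<^sup>n\<close>. The numbers
  \<open>h\<^sub>n = 4\<^sup>n\<^sup>+\<^sup>1 n! m\<^sub>n\<close> express \<open>e\<^sub>n = 4\<^sup>n n! d\<^sub>n\<close> recursively by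
  \<open>e\<^sub>n\<^sub>+\<^sub>1 = \<plusminus> \<Sum>\<^sub>i (n choose i) h\<^sub>i e\<^sub>n\<^sub>-\<^sub>i\<close> (\<open>moment_recurrence\<close>), the sign being that of the power of
  \<open>Den\<close>. Since \<open>h\<^sub>0 = -1\<close> while \<open>h\<^sub>n\<close> is twice a 2-integral number for \<open>n \<ge> 1\<close> (\<open>cumulant_even\<close>),
  the number \<open>e\<^sub>n\<^sub>+\<^sub>1\<close> is congruent to \<open>e\<^sub>n\<close> modulo 2 and every \<open>e\<^sub>n\<close> is a 2-adic unit, like
  \<open>e\<^sub>0 = 1\<close>.

  The numbers \<open>m\<^sub>n\<close> are determined by the difference equation
  \<open>(Z - 3)\<^sup>2 Den(Z - 4) = (Z - 2)(Z - 4) Den(Z)\<close> (\<open>Den_functional_equation\<close>). It reflects that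
  \<open>Den\<close> is, up to a Gamma factor, the Mellin transform of a product of two Bessel functions:
  \<open>a0 k\<close> are the coefficients in the asymptotic expansion of \<open>K\<^sub>0\<close>, so that, formally,
  \<open>K\<^sub>0(u/p) K\<^sub>0(u/q)\<close> is a constant multiple of \<open>P(u) = u\<^sup>-\<^sup>1 e\<^sup>-\<^sup>u \<Sum> G\<^sub>n u\<^sup>-\<^sup>n\<close>. With \<open>\<theta> = u d/du\<close>, the
  two factors satisfy \<open>\<theta>\<^sup>2 f = c\<^sup>2 u\<^sup>2 f\<close> and \<open>\<theta>\<^sup>2 g = -c\<^sup>2 u\<^sup>2 g\<close> for \<open>c = 1/p\<close>, because
  \<open>1/p\<^sup>2 = -1/q\<^sup>2\<close>. For this reason the product satisfies the two-term equation
  \<open>(\<theta> - 2) \<theta>\<^sup>3 P = u\<^sup>4 P\<close>, and the factor \<open>u\<^sup>4\<close> becomes the shift of \<open>Z\<close> by 4. In coefficients the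
  differential equation is \<open>G_differential_equation\<close>.
\<close>

section \<open>The differential equation of a product of Bessel functions\<close>

definition bessel_fps :: "complex \<Rightarrow> complex fps" where
  "bessel_fps p = Abs_fps (\<lambda>k. a0 k * p ^ k)"

lemma a0_Suc: "8 * of_nat (Suc k) * a0 (Suc k) = - ((2 * of_nat k + 1) ^ 2) * a0 k"
  by (simp add: a0_def divide_simps del: of_nat_Suc) 

lemma G_eq_product: "Abs_fps G = bessel_fps (1 + \<i>) * bessel_fps (1 - \<i>)"
  by (rule fps_ext)
     (simp add: G_def bessel_fps_def fps_mult_nth atLeast0AtMost mult.assoc mult.left_commute)

lemma fps_X_square_deriv_nth:
  fixes Y :: "'a :: comm_ring_1 fps"
  shows "fps_nth (fps_X ^ 2 * fps_deriv Y) n = (of_nat n - 1) * (if n = 0 then 0 else fps_nth Y (n - 1))"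
proof -
  consider "n = 0" | "n = 1" | m where "n = Suc (Suc m)"
    by (metis One_nat_def not0_implies_Suc)
  then show ?thesis by cases (auto simp: fps_X_power_mult_nth)
qed

text \<open>
  Bessel's equation for \<open>f(u) = u\<^sup>-\<^sup>1\<^sup>/\<^sup>2 e\<^sup>-\<^sup>c\<^sup>u F(1/u)\<close>, written as a first-order system in the variable
  \<open>x = 1/u\<close>: the series \<open>F1\<close> plays the role of \<open>-x \<theta> f\<close> after the prefactor
  \<open>u\<^sup>-\<^sup>1\<^sup>/\<^sup>2 e\<^sup>-\<^sup>c\<^sup>u\<close> has been removed. In coefficients it is the two-term recurrence of \<open>a0\<close>.
\<close>

lemma bessel_system:
  fixes p c :: complex
  assumes pc: "p * c = 1"
  defines "F \<equiv> bessel_fps p"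
  defines "F1 \<equiv> fps_X ^ 2 * fps_deriv F + (fps_const (1/2) * fps_X + fps_const c) * F"
  shows "fps_X ^ 2 * fps_deriv F1
           = (fps_const (1/2) * fps_X - fps_const c) * F1 + fps_const (c ^ 2) * F"
proof (rule fps_ext)
  fix n
  have F1_nth: "fps_nth F1 n = (of_nat n - 1/2) * (if n = 0 then 0 else fps_nth F (n - 1)) + c * fps_nth F n" for n
    unfolding F1_def
    by (simp add: fps_X_square_deriv_nth ring_distribs mult.assoc)
  have F_rec: "2 * c * of_nat (Suc k) * fps_nth F (Suc k) = - ((of_nat k + 1/2) ^ 2) * fps_nth F k" for k
  proof -
    have "8 * (2 * c * of_nat (Suc k) * fps_nth F (Suc k))
        = 2 * p ^ k * (p * c) * (8 * of_nat (Suc k) * a0 (Suc k))"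
      by (simp add: F_def bessel_fps_def)
    also have "\<dots> = 2 * p ^ k * (- ((2 * of_nat k + 1) ^ 2) * a0 k)"
      unfolding a0_Suc pc by simp
    also have "(2 * of_nat k + 1 :: complex) = 2 * (of_nat k + 1/2)"
      by simp
    also have "2 * p ^ k * (- ((2 * (of_nat k + 1/2)) ^ 2) * a0 k)
        = 8 * (- ((of_nat k + 1/2) ^ 2) * fps_nth F k)"
      unfolding power_mult_distrib by (simp add: F_def bessel_fps_def)
    finally show ?thesis by (rule mult_left_cancel[THEN iffD1, rotated]) simp
  qed
  consider "n = 0" | "n = 1" | m where "n = Suc (Suc m)"
    by (metis One_nat_def not0_implies_Suc)
  then show "fps_nth (fps_X ^ 2 * fps_deriv F1) n
           = fps_nth ((fps_const (1/2) * fps_X - fps_const c) * F1 + fps_const (c ^ 2) * F) n"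
  proof cases
    case 3
    define x f0 f1 f2 where "x = (of_nat m :: complex)" and "f0 = fps_nth F m"
      and "f1 = fps_nth F (Suc m)" and "f2 = fps_nth F (Suc (Suc m))"
    have "2 * c * (x + 1) * f1 = - ((x + 1/2) ^ 2) * f0"
      using F_rec[of m] by (simp add: x_def f0_def f1_def add.commute)
    moreover have "((x + 1) * ((x + 1/2) * f0 + c * f1))
        - (1/2 * ((x + 1/2) * f0 + c * f1) - c * ((x + 3/2) * f1 + c * f2) + c ^ 2 * f2)
        = (x + 1/2) ^ 2 * f0 + 2 * c * (x + 1) * f1"
      by (simp add: power2_eq_square field_simps)
    ultimately have "(x + 1) * ((x + 1/2) * f0 + c * f1)
        = 1/2 * ((x + 1/2) * f0 + c * f1) - c * ((x + 3/2) * f1 + c * f2) + c ^ 2 * f2"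
      by simp
    then show ?thesis
      by (simp add: 3 fps_X_square_deriv_nth ring_distribs mult.assoc F1_nth 
            flip: f0_def f1_def f2_def x_def) (simp add: field_simps)
  qed (simp_all add: fps_X_square_deriv_nth ring_distribs mult.assoc F1_nth power2_eq_square)
qed

text \<open>
  On coefficient sequences this is \<open>y\<^sub>n \<mapsto> y\<^sub>n + (n - b) y\<^sub>n\<^sub>-\<^sub>1\<close>. It is what multiplication by
  \<open>Z - a\<close> does, for \<open>b = a - k\<close>, to the coefficients of a series of reciprocal products
  \<open>1/((Z - 1)\<dots>(Z - n - k - 1))\<close>, and at the same time a first-order differential operator, which links that series to the Bessel functions.
\<close>

definition euler_op :: "complex \<Rightarrow> complex fps \<Rightarrow> complex fps" where
  "euler_op b Y = Y + fps_X ^ 2 * fps_deriv Y + fps_const (1 - b) * fps_X * Y"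

lemma euler_op_nth:
  "fps_nth (euler_op b Y) n = fps_nth Y n + (of_nat n - b) * (if n = 0 then 0 else fps_nth Y (n - 1))"
  by (simp add: euler_op_def fps_X_square_deriv_nth mult.assoc) (simp add: algebra_simps)

lemma euler_op_const_mult: "euler_op b (fps_const c * Y) = fps_const c * euler_op b Y"
  by (simp add: euler_op_def algebra_simps)

text \<open>
  The module spanned over the polynomials by the four products \<open>FK\<close>, \<open>F1 K + F K1\<close>,
  \<open>F K1 - F1 K\<close> and \<open>F1 K1\<close> is closed under \<open>x\<^sup>2 d/dx\<close>.
  Since \<open>c\<^sup>2 + c'\<^sup>2 = 0\<close>, the differential system is a cycle \<open>P \<rightarrow> S \<rightarrow> 2W\<close>,
  \<open>W \<rightarrow> c\<^sup>2 V\<close>, \<open>V \<rightarrow> -2c\<^sup>2 P\<close>; running through it once multiplies \<open>P\<close> by \<open>-4c\<^sup>4 = 1\<close>.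
\<close>

lemma G_differential_equation:
  "euler_op 1 (euler_op 2 (euler_op 1 (euler_op 0 (Abs_fps G)))) = Abs_fps G"
proof -
  define c c' :: complex where "c = (1 - \<i>) / 2" and "c' = (1 + \<i>) / 2"
  define F where "F = bessel_fps (1 + \<i>)"
  define K where "K = bessel_fps (1 - \<i>)"
  define F1 where "F1 = fps_X ^ 2 * fps_deriv F + (fps_const (1/2) * fps_X + fps_const c) * F"
  define K1 where "K1 = fps_X ^ 2 * fps_deriv K + (fps_const (1/2) * fps_X + fps_const c') * K"
  have F1: "fps_X ^ 2 * fps_deriv F1
           = (fps_const (1/2) * fps_X - fps_const c) * F1 + fps_const (c ^ 2) * F"
    unfolding F1_def F_def by (rule bessel_system) (simp add: c_def algebra_simps)
  have K1: "fps_X ^ 2 * fps_deriv K1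
           = (fps_const (1/2) * fps_X - fps_const c') * K1 + fps_const (c' ^ 2) * K"
    unfolding K1_def K_def by (rule bessel_system) (simp add: c'_def algebra_simps)
  define H where "H = (fps_const (1/2) :: complex fps)"
  define C where "C = fps_const c"
  define C' where "C' = fps_const c'"
  have H: "2 * H = 1" by (simp add: H_def numeral_fps_const)
  have CC': "C + C' = 1" by (simp add: C_def C'_def c_def c'_def field_simps)
  have "c' ^ 2 = - (c ^ 2)" by (simp add: c_def c'_def power2_eq_square field_simps)
  then have C'2: "fps_const (c' ^ 2) = - (C ^ 2)" by (simp add: C_def)
  have C2: "fps_const (c ^ 2) = C ^ 2" by (simp add: C_def)
  have C4: "- 4 * C ^ 2 * C ^ 2 = 1"
    by (simp add: C_def c_def power2_eq_square numeral_fps_const field_simps)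
  have F': "fps_X ^ 2 * fps_deriv F = F1 - (H * fps_X + C) * F"
    by (simp add: F1_def H_def C_def)
  have K': "fps_X ^ 2 * fps_deriv K = K1 - (H * fps_X + C') * K"
    by (simp add: K1_def H_def C'_def)
  note F1' = F1[unfolded C2, folded H_def C_def]
  note K1' = K1[unfolded C'2, folded H_def C'_def]
  define P where "P = F * K"
  define S where "S = F1 * K + F * K1"
  define W where "W = F1 * K1"
  define V where "V = F * K1 - F1 * K"
  \<comment> \<open>Expressed through \<open>h = x/2\<close> and \<open>C\<close> alone, the four equations of the cycle
      become identities in a commutative ring.\<close>
  define h where "h = H * fps_X"
  have X: "fps_X = 2 * h" by (simp add: h_def H flip: mult.assoc)
  have C': "C' = 1 - C" using CC' by (simp add: algebra_simps)
  have product_rule: "fps_X ^ 2 * fps_deriv (A * B) = (fps_X ^ 2 * fps_deriv A) * B + A * (fps_X ^ 2 * fps_deriv B)"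
    for A B :: "complex fps" by (simp add: algebra_simps)
  note rules = F' K' F1' K1' product_rule fps_deriv_add fps_deriv_sub distrib_left right_diff_distrib
  have "fps_X ^ 2 * fps_deriv P = S - (fps_X + 1) * P"
    unfolding P_def S_def rules unfolding h_def[symmetric] unfolding X C' by (simp add: algebra_simps)
  then have S: "euler_op 0 P = S"
    by (simp add: euler_op_def algebra_simps)
  have "fps_X ^ 2 * fps_deriv S = 2 * W - S"
    unfolding W_def S_def rules unfolding h_def[symmetric] unfolding X C' by (simp add: algebra_simps power2_eq_square)
  then have W: "euler_op 1 S = 2 * W"
    by (simp add: euler_op_def algebra_simps)
  have "fps_X ^ 2 * fps_deriv W = (fps_X - 1) * W + C ^ 2 * V"
    unfolding W_def V_def rules unfolding h_def[symmetric] unfolding X C' by (simp add: algebra_simps power2_eq_square)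
  then have V: "euler_op 2 W = C ^ 2 * V"
    by (simp add: euler_op_def algebra_simps flip: fps_const_neg)
  have "fps_X ^ 2 * fps_deriv V = - V - 2 * C ^ 2 * P"
    unfolding P_def V_def rules unfolding h_def[symmetric] unfolding X C' by (simp add: algebra_simps power2_eq_square)
  then have P: "euler_op 1 V = - 2 * C ^ 2 * P"
    by (simp add: euler_op_def)
  have "euler_op 1 (euler_op 2 (euler_op 1 (euler_op 0 P))) = euler_op 1 (euler_op 2 (fps_const 2 * W))"
    by (simp add: S W numeral_fps_const)
  also have "\<dots> = euler_op 1 (fps_const (2 * c ^ 2) * V)"
    by (simp add: euler_op_const_mult V C_def mult.assoc flip: fps_const_mult)
  also have "\<dots> = fps_const (2 * c ^ 2) * (- 2 * C ^ 2 * P)"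
    by (simp only: euler_op_const_mult P)
  also have "fps_const (2 * c ^ 2) = 2 * C ^ 2"
    by (simp add: C_def numeral_fps_const)
  also have "2 * C ^ 2 * (- 2 * C ^ 2 * P) = (- 4 * C ^ 2 * C ^ 2) * P"
    by (simp add: algebra_simps)
  finally show ?thesis
    unfolding C4 by (simp add: P_def F_def K_def G_eq_product)
qed

section \<open>The difference equation of the denominator series\<close>

definition recip_prod :: "nat \<Rightarrow> complex fps" where
  "recip_prod n = (\<Prod>j=1..n. fps_X / (1 - of_nat j * fps_X))"

lemma recip_prod_0 [simp]: "recip_prod 0 = 1"
  by (simp add: recip_prod_def)

lemma recip_prod_Suc:
  "(1 - fps_const (of_nat (Suc n)) * fps_X) * recip_prod (Suc n) = fps_X * recip_prod n"
proof -
  let ?u = "1 - fps_const (of_nat (Suc n)) * fps_X :: complex fps"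
  have unit: "fps_nth ?u 0 \<noteq> 0"
    by simp
  have "fps_X / (1 - of_nat (Suc n) * fps_X) = fps_X * inverse ?u"
    unfolding fps_of_nat[symmetric] by (rule fps_divide_unit[OF unit])
  then have "?u * (fps_X / (1 - of_nat (Suc n) * fps_X)) = fps_X * (?u * inverse ?u)"
    by (simp only: mult.left_commute)
  also have "\<dots> = fps_X"
    by (simp only: inverse_mult_eq_1'[OF unit] mult_1_right)
  finally have u: "?u * (fps_X / (1 - of_nat (Suc n) * fps_X)) = fps_X" .
  have "recip_prod (Suc n) = recip_prod n * (fps_X / (1 - of_nat (Suc n) * fps_X))"
    by (simp add: recip_prod_def)
  then have "?u * recip_prod (Suc n) = recip_prod n * (?u * (fps_X / (1 - of_nat (Suc n) * fps_X)))"
    by (simp only: mult.left_commute)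
  then show ?thesis
    unfolding u by (simp only: mult.commute)
qed

lemma recip_prod_nth_eq_0: "m < n \<Longrightarrow> fps_nth (recip_prod n) m = 0"
proof -
  assume "m < n"
  have "recip_prod n = (\<Prod>j=1..n. fps_X * inverse (1 - of_nat j * fps_X))"
    unfolding recip_prod_def by (intro prod.cong refl) (simp add: fps_divide_unit)
  also have "\<dots> = fps_X ^ n * (\<Prod>j=1..n. inverse (1 - of_nat j * fps_X))"
    by (simp add: prod.distrib)
  finally show ?thesis
    using \<open>m < n\<close> by (simp add: fps_X_power_mult_nth)
qed

text \<open>
  The inverse factorial series \<open>\<Sum>\<^sub>n y\<^sub>n / ((Z - 1)\<dots>(Z - n - k))\<close>. The offset \<open>k\<close> in the number of
  factors is what multiplication by a linear factor in \<open>Z\<close> lowers by one.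
\<close>

definition factorial_series :: "nat \<Rightarrow> complex fps \<Rightarrow> complex fps" where
  "factorial_series k Y = Abs_fps (\<lambda>m. \<Sum>n\<le>m. fps_nth Y n * fps_nth (recip_prod (n + k)) m)"

lemma factorial_series_nth:
  assumes "m \<le> N"
  shows "fps_nth (factorial_series k Y) m
           = fps_nth (\<Sum>n\<le>N. fps_const (fps_nth Y n) * recip_prod (n + k)) m"
proof -
  have "(\<Sum>n\<le>m. fps_nth Y n * fps_nth (recip_prod (n + k)) m)
      = (\<Sum>n\<le>N. fps_nth Y n * fps_nth (recip_prod (n + k)) m)"
    using assms by (intro sum.mono_neutral_left) (auto simp: recip_prod_nth_eq_0)
  then show ?thesis
    by (simp add: factorial_series_def fps_sum_nth)
qed

lemma Den_eq_factorial_series: "Den = factorial_series 0 (Abs_fps G)"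
  by (rule fps_ext) (simp add: Den_nth Den_term_def factorial_series_def recip_prod_def)

text \<open>
  With \<open>T\<^sub>j\<close> for the product of \<open>j\<close> factors, \<open>(Z - a) T\<^sub>j\<^sub>+\<^sub>1 = T\<^sub>j + (j + 1 - a) T\<^sub>j\<^sub>+\<^sub>1\<close>; collecting
  the coefficient of each \<open>T\<^sub>j\<close> gives \<open>euler_op\<close>. The last summand is the boundary term of the finite
  sum, which is of too high an order to affect the limit.
\<close>

lemma one_minus_mult_factorial_sum:
  "(1 - fps_const a * fps_X) * (\<Sum>n\<le>N. fps_const (fps_nth Y n) * recip_prod (n + Suc k))
     = fps_X * ((\<Sum>n\<le>N. fps_const (fps_nth (euler_op (a - of_nat k) Y) n) * recip_prod (n + k))
         + fps_const ((of_nat (Suc N + k) - a) * fps_nth Y N) * recip_prod (Suc N + k))"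
proof -
  have step: "(1 - fps_const a * fps_X) * recip_prod (Suc j)
      = fps_X * (recip_prod j + fps_const (of_nat (Suc j) - a) * recip_prod (Suc j))" for j
    using recip_prod_Suc[of j]
    by (simp add: algebra_simps flip: fps_const_sub del: of_nat_Suc fps_const_sub)
  have term_step: "(1 - fps_const a * fps_X) * (fps_const y * recip_prod (Suc j))
      = fps_X * (fps_const y * recip_prod j + fps_const ((of_nat (Suc j) - a) * y) * recip_prod (Suc j))"
    for y j
    by (subst mult.left_commute, subst step)
       (simp add: algebra_simps flip: fps_const_mult del: of_nat_Suc fps_const_mult)
  show ?thesis
  proof (induction N)
    case 0
    show ?case using term_step[of "fps_nth Y 0" k] by (simp add: euler_op_nth)
  next
    case (Suc N)
    let ?y = "fps_nth Y (Suc N)" and ?\<alpha> = "(of_nat (Suc N + k) - a) * fps_nth Y N"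
    let ?\<beta> = "(of_nat (Suc (Suc N + k)) - a) * fps_nth Y (Suc N)"
    let ?S' = "\<Sum>n\<le>N. fps_const (fps_nth (euler_op (a - of_nat k) Y) n) * recip_prod (n + k)"
    let ?T = "recip_prod (Suc N + k)" and ?T' = "recip_prod (Suc (Suc N + k))"
    have coeff: "fps_nth (euler_op (a - of_nat k) Y) (Suc N) = ?\<alpha> + ?y"
      by (simp add: euler_op_nth algebra_simps)
    have "(1 - fps_const a * fps_X) * (\<Sum>n\<le>Suc N. fps_const (fps_nth Y n) * recip_prod (n + Suc k))
        = fps_X * (?S' + fps_const ?\<alpha> * ?T) + fps_X * (fps_const ?y * ?T + fps_const ?\<beta> * ?T')"
      unfolding sum.atMost_Suc distrib_left[of "1 - fps_const a * fps_X"] Suc.IH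
        add_Suc_right[of "Suc N" k] term_step ..
    also have "\<dots> = fps_X * ((?S' + fps_const (?\<alpha> + ?y) * ?T) + fps_const ?\<beta> * ?T')"
      unfolding fps_const_add[symmetric] distrib_right distrib_left by (simp only: add.assoc)
    finally show ?case
      unfolding sum.atMost_Suc coeff by simp
  qed
qed

lemma one_minus_mult_factorial_series:
  "(1 - fps_const a * fps_X) * factorial_series (Suc k) Y
     = fps_X * factorial_series k (euler_op (a - of_nat k) Y)"
proof (rule fps_ext)
  fix m
  let ?S = "\<Sum>n\<le>m. fps_const (fps_nth Y n) * recip_prod (n + Suc k)"
  let ?S' = "\<Sum>n\<le>m. fps_const (fps_nth (euler_op (a - of_nat k) Y) n) * recip_prod (n + k)"
  have "fps_nth ((1 - fps_const a * fps_X) * factorial_series (Suc k) Y) m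
      = fps_nth ((1 - fps_const a * fps_X) * ?S) m"
    unfolding fps_mult_nth by (intro sum.cong refl arg_cong2[where f = times] factorial_series_nth) auto
  also have "\<dots> = fps_nth (fps_X * ?S') m"
    unfolding one_minus_mult_factorial_sum
    by (cases m) (simp_all add: recip_prod_nth_eq_0)
  also have "\<dots> = fps_nth (fps_X * factorial_series k (euler_op (a - of_nat k) Y)) m"
    using factorial_series_nth[of "m - 1" m k "euler_op (a - of_nat k) Y"] by (cases m) simp_all
  finally show "fps_nth ((1 - fps_const a * fps_X) * factorial_series (Suc k) Y) m
      = fps_nth (fps_X * factorial_series k (euler_op (a - of_nat k) Y)) m" .
qed

text \<open>
  The expansion of \<open>1/(Z - 4)\<close> in \<open>v = 1/Z\<close>, so that composing with it replaces \<open>Z\<close> by \<open>Z - 4\<close>.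
\<close>

definition shift4 :: "complex fps" where
  "shift4 = fps_X * inverse (1 - fps_const 4 * fps_X)"

lemma shift4_0 [simp]: "fps_nth shift4 0 = 0"
  by (simp add: shift4_def)

lemma one_minus_mult_shift4: "(1 - fps_const 4 * fps_X) * shift4 = fps_X"
  unfolding shift4_def by (subst mult.left_commute) (simp add: inverse_mult_eq_1')

text \<open>
  Shifting \<open>Z\<close> by 4 turns the factors \<open>Z - 1, \<dots>, Z - n\<close> into \<open>Z - 5, \<dots>, Z - n - 4\<close>; the first four
  factors complete them to the product of length \<open>n + 4\<close>.
\<close>

lemma recip_prod_shift4: "recip_prod 4 * (recip_prod n oo shift4) = recip_prod (n + 4)"
proof (induction n)
  case (Suc n)
  let ?A = "recip_prod n oo shift4" and ?A' = "recip_prod (Suc n) oo shift4"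
  let ?u = "1 - fps_const (of_nat (Suc (n + 4))) * fps_X :: complex fps"
  let ?c = "fps_const (of_nat (Suc n)) :: complex fps"
  have "(1 - ?c * shift4) * ?A' = shift4 * ?A"
    using arg_cong[OF recip_prod_Suc[of n], of "\<lambda>f. f oo shift4"]
    by (simp add: fps_compose_mult_distrib fps_compose_sub_distrib fps_X_fps_compose_startby0 del: of_nat_Suc)
  then have "(1 - fps_const 4 * fps_X) * ((1 - ?c * shift4) * ?A') = fps_X * ?A"
    by (simp only: mult.assoc[symmetric] one_minus_mult_shift4)
  also have "(1 - fps_const 4 * fps_X) * ((1 - ?c * shift4) * ?A')
      = ((1 - fps_const 4 * fps_X) - ?c * ((1 - fps_const 4 * fps_X) * shift4)) * ?A'"
    by (simp add: algebra_simps)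
  also have "(1 - fps_const 4 * fps_X) - ?c * ((1 - fps_const 4 * fps_X) * shift4) = ?u"
    unfolding one_minus_mult_shift4
    by (simp add: algebra_simps flip: fps_const_add)
  finally have "?u * (recip_prod 4 * ?A') = fps_X * (recip_prod 4 * ?A)"
    by (simp only: mult.left_commute)
  also have "\<dots> = ?u * recip_prod (Suc n + 4)"
    using recip_prod_Suc[of "n + 4"] by (simp add: Suc.IH)
  finally show ?case
  proof (rule mult_left_cancel[THEN iffD1, rotated])
    have "fps_nth ?u 0 = 1" by simp
    then show "?u \<noteq> 0" by (metis fps_zero_nth zero_neq_one)
  qed
qed simp

lemma factorial_series_shift4:
  "recip_prod 4 * (factorial_series 0 Y oo shift4) = factorial_series 4 Y"
proof (rule fps_ext)
  fix m
  let ?S = "\<Sum>n\<le>m. fps_const (fps_nth Y n) * recip_prod n"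
  have coeff: "fps_nth (factorial_series 0 Y oo shift4) i = fps_nth (?S oo shift4) i" if "i \<le> m" for i
    unfolding fps_compose_nth
    using that factorial_series_nth[where k = 0 and Y = Y and N = m]
    by (intro sum.cong refl arg_cong2[where f = times]) auto
  have "fps_nth (recip_prod 4 * (factorial_series 0 Y oo shift4)) m
      = fps_nth (recip_prod 4 * (?S oo shift4)) m"
    unfolding fps_mult_nth by (intro sum.cong refl arg_cong2[where f = times] coeff) auto
  also have "recip_prod 4 * (?S oo shift4)
      = (\<Sum>n\<le>m. fps_const (fps_nth Y n) * (recip_prod 4 * (recip_prod n oo shift4)))"
    by (simp add: fps_compose_sum_distrib fps_compose_mult_distrib sum_distrib_left mult.left_commute)
  also have "fps_nth \<dots> m = fps_nth (factorial_series 4 Y) m"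
    by (simp only: recip_prod_shift4 factorial_series_nth[OF order_refl])
  finally show "fps_nth (recip_prod 4 * (factorial_series 0 Y oo shift4)) m
      = fps_nth (factorial_series 4 Y) m" .
qed

text \<open>
  The series \<open>Den(Z - 4) / ((Z - 1)(Z - 2)(Z - 3)(Z - 4))\<close> is the inverse factorial series of \<open>G\<close> with
  offset 4. Multiplying it by \<open>(Z - 3)\<^sup>3 (Z - 1)\<close> lowers the offset to 0 and applies to \<open>G\<close> exactly
  the four operators of \<open>G_differential_equation\<close>, so the result is \<open>Den(Z)\<close> again.
\<close>

lemma Den_functional_equation:
  "(1 - fps_const 3 * fps_X) ^ 2 * (Den oo shift4)
     = (1 - fps_const 2 * fps_X) * (1 - fps_const 4 * fps_X) * Den"
proof -
  define u where "u = (\<lambda>a. 1 - fps_const a * fps_X :: complex fps)"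
  define T where "T = recip_prod 4"
  define D where "D = Den oo shift4"
  have uX: "u a * (fps_X * B) = fps_X * (u a * B)" for a B
    by (rule mult.left_commute)
  let ?L = "factorial_series" and ?X = "fps_X :: complex fps"
  let ?Y0 = "Abs_fps G"
  let ?Y1 = "euler_op 0 ?Y0" 
  let ?Y2 = "euler_op 1 ?Y1"
  let ?Y3 = "euler_op 2 ?Y2"
  \<comment> \<open>The factor \<open>Z - a\<close> at offset \<open>k + 1\<close> contributes the operator with parameter \<open>b = a - k\<close>:
      the parameters \<open>0, 1, 2, 1\<close> in turn force \<open>a = 3, 3, 3, 1\<close>.\<close>
  have E: "u 3 * ?L 4 ?Y0 = ?X * ?L 3 ?Y1" "u 3 * ?L 3 ?Y1 = ?X * ?L 2 ?Y2"
    "u 3 * ?L 2 ?Y2 = ?X * ?L 1 ?Y3"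
    using one_minus_mult_factorial_series[of 3 3 ?Y0] one_minus_mult_factorial_series[of 3 2 ?Y1]
      one_minus_mult_factorial_series[of 3 1 ?Y2]
    by (simp_all add: u_def eval_nat_numeral)
  have E4: "u 1 * ?L 1 ?Y3 = ?X * ?L 0 ?Y0"
    using one_minus_mult_factorial_series[of 1 0 ?Y3] unfolding u_def
    by (simp add: G_differential_equation)
  have "u 1 * u 3 ^ 3 * ?L 4 ?Y0 = u 1 * (u 3 * (u 3 * (u 3 * ?L 4 ?Y0)))"
    by (simp add: eval_nat_numeral)
  also have "\<dots> = ?X ^ 3 * (u 1 * ?L 1 ?Y3)"
    by (simp only: E uX) (simp add: eval_nat_numeral)
  also have "\<dots> = ?X ^ 4 * Den"
    unfolding E4 by (simp add: Den_eq_factorial_series eval_nat_numeral)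
  finally have TD: "u 1 * u 3 ^ 3 * (T * D) = ?X ^ 4 * Den"
    by (simp add: T_def D_def Den_eq_factorial_series factorial_series_shift4)
  have T: "u 1 * u 2 * u 3 * u 4 * T = ?X ^ 4"
  proof -
    have "u 1 * recip_prod 1 = ?X" "u 2 * recip_prod 2 = ?X * recip_prod 1"
      "u 3 * recip_prod 3 = ?X * recip_prod 2" "u 4 * T = ?X * recip_prod 3"
      using recip_prod_Suc[of 0] recip_prod_Suc[of 1] recip_prod_Suc[of 2] recip_prod_Suc[of 3]
      by (simp_all add: u_def T_def eval_nat_numeral)
    then show ?thesis
      by (simp add: mult.assoc uX eval_nat_numeral)
  qed
  have "?X ^ 4 * (u 3 ^ 2 * D) = (u 1 * u 2 * u 3 * u 4 * T) * (u 3 ^ 2 * D)"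
    by (simp only: T)
  also have "\<dots> = u 2 * u 4 * (u 1 * u 3 ^ 3 * (T * D))"
    by (simp add: eval_nat_numeral mult_ac)
  also have "\<dots> = ?X ^ 4 * (u 2 * u 4 * Den)"
    unfolding TD by (simp add: mult_ac)
  finally have "u 3 ^ 2 * D = u 2 * u 4 * Den"
    by simp
  then show ?thesis by (simp add: u_def D_def)
qed

section \<open>The logarithmic derivative\<close>

definition log_deriv :: "complex fps" where
  "log_deriv = fps_deriv Den * inverse Den"

lemma deriv_Den: "fps_deriv Den = log_deriv * Den"
  by (simp add: log_deriv_def mult.assoc inverse_mult_eq_1 Den_nth_0)

lemma deriv_Den_powi:
  assumes "s \<in> {1, -1}"
  shows "fps_deriv (Den powi s) = of_int s * log_deriv * Den powi s"
  using assms
proof (elim insertE)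
  assume s: "s = -1"
  have "fps_deriv (inverse Den) = - fps_deriv Den * (inverse Den)\<^sup>2"
    by (rule fps_inverse_deriv) (simp add: Den_nth_0)
  then show ?thesis
    unfolding s by (simp add: log_deriv_def power2_eq_square mult.assoc)
qed (simp_all add: deriv_Den)

text \<open>
  The logarithmic derivative turns the multiplicative difference equation of \<open>Den\<close> into an additive
  one with explicit right-hand side.
\<close>

lemma log_deriv_shift4:
  "(log_deriv oo shift4) * fps_deriv shift4 - log_deriv
     = fps_const 6 * inverse (1 - fps_const 3 * fps_X)
       - fps_const 2 * inverse (1 - fps_const 2 * fps_X)
       - fps_const 4 * inverse (1 - fps_const 4 * fps_X)"
proof -
  define u where "u = (\<lambda>a. 1 - fps_const a * fps_X :: complex fps)"
  have u': "fps_deriv (u a) = - fps_const a" for a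
    by (simp add: u_def)
  have u_nz: "u a \<noteq> 0" for a
  proof
    assume "u a = 0"
    then have "fps_nth (u a) 0 = 0" by simp
    then show False by (simp add: u_def)
  qed
  have inv: "u a * inverse (u a) = 1" for a
    by (rule inverse_mult_eq_1') (simp add: u_def)
  define E N where "E = Den oo shift4" and "N = (log_deriv oo shift4) * fps_deriv shift4"
  define Q where "Q = u 2 * u 4 * Den"
  have Q: "u 3 ^ 2 * E = Q"
    unfolding Q_def E_def u_def by (rule Den_functional_equation)
  have Q_nz: "Q \<noteq> 0"
    using u_nz Den_nth_0 by (auto simp: Q_def)
  have E': "fps_deriv E = N * E"
    by (simp add: E_def N_def fps_compose_deriv deriv_Den fps_compose_mult_distrib mult_ac)
  have "fps_deriv (u 3 ^ 2 * E) = N * Q - fps_const 6 * (u 3 * E)"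
    by (simp add: E' u' power2_eq_square algebra_simps flip: Q numeral_fps_const)
  moreover have "fps_deriv Q = log_deriv * Q - fps_const 2 * (u 4 * Den) - fps_const 4 * (u 2 * Den)"
    by (simp add: Q_def u' deriv_Den algebra_simps del: fps_const_neg)
  ultimately have "N * Q - fps_const 6 * (u 3 * E)
      = log_deriv * Q - fps_const 2 * (u 4 * Den) - fps_const 4 * (u 2 * Den)"
    by (simp only: Q)
  then have "N * Q - log_deriv * Q
      = fps_const 6 * (u 3 * E) - fps_const 2 * (u 4 * Den) - fps_const 4 * (u 2 * Den)"
    by (simp add: algebra_simps)
  also have "u 3 * E = inverse (u 3) * Q"
  proof -
    have "inverse (u 3) * Q = (u 3 * inverse (u 3)) * (u 3 * E)"
      by (simp add: power2_eq_square mult_ac flip: Q)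
    then show ?thesis by (simp add: inv)
  qed
  also have "u 4 * Den = inverse (u 2) * Q"
  proof -
    have "inverse (u 2) * Q = (u 2 * inverse (u 2)) * (u 4 * Den)"
      by (simp add: Q_def mult_ac)
    then show ?thesis by (simp add: inv)
  qed
  also have "u 2 * Den = inverse (u 4) * Q"
  proof -
    have "inverse (u 4) * Q = (u 4 * inverse (u 4)) * (u 2 * Den)"
      by (simp add: Q_def mult_ac)
    then show ?thesis by (simp add: inv)
  qed
  finally have "Q * (N - log_deriv)
      = Q * (fps_const 6 * inverse (u 3) - fps_const 2 * inverse (u 2) - fps_const 4 * inverse (u 4))"
    by (simp add: algebra_simps)
  then show ?thesis
    using Q_nz unfolding N_def u_def by simp
qed

text \<open>
  \<open>shift4\<^sup>j shift4' = v\<^sup>j / (1 - 4v)\<^sup>j\<^sup>+\<^sup>2\<close>, a negative binomial series.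
\<close>

lemma shift4_power_deriv_nth:
  "fps_nth (shift4 ^ j * fps_deriv shift4) N
     = (if j \<le> N then of_nat (Suc N choose Suc j) * 4 ^ (N - j) else 0)"
proof -
  define w where "w = (1 - fps_const 4 * fps_X :: complex fps)"
  have w: "inverse w * w = 1"
    by (rule inverse_mult_eq_1) (simp add: w_def)
  have wX: "w * shift4 = fps_X"
    unfolding w_def by (rule one_minus_mult_shift4)
  have "w * (w * fps_deriv shift4) = 1"
  proof -
    have "fps_deriv (w * shift4) = 1" by (simp add: wX)
    then have "w * fps_deriv shift4 = 1 + fps_const 4 * shift4"
      by (simp add: w_def algebra_simps)
    then have "w * (w * fps_deriv shift4) = w + fps_const 4 * (w * shift4)"
      by (simp add: algebra_simps)
    then show ?thesis unfolding wX by (simp add: w_def)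
  qed
  then have "(inverse w * w) * ((inverse w * w) * fps_deriv shift4) = inverse w * inverse w"
    by (simp add: mult_ac)
  then have "fps_deriv shift4 = inverse w * inverse w"
    by (simp only: w mult_1_left)
  moreover have "shift4 = fps_X * inverse w"
    by (simp only: shift4_def w_def)
  ultimately have "shift4 ^ j * fps_deriv shift4 = (fps_X * inverse w) ^ j * (inverse w * inverse w)"
    by simp
  also have "\<dots> = fps_X ^ j * inverse w ^ (j + 2)"
    by (simp only: power_mult_distrib power_add power2_eq_square mult.assoc)
  also have "inverse w ^ (j + 2) = inverse (w ^ (j + 2))"
    by (rule fps_inverse_power[symmetric])
  also have "inverse (w ^ (j + 2)) = Abs_fps (\<lambda>k. of_nat ((j + 2 + k - 1) choose k) * 4 ^ k)"
    unfolding w_def by (rule one_minus_const_fps_X_neg_power') simp_all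
  finally have "fps_nth (shift4 ^ j * fps_deriv shift4) N
      = (if j \<le> N then of_nat ((j + 2 + (N - j) - 1) choose (N - j)) * 4 ^ (N - j) else 0)"
    by (simp add: fps_X_power_mult_nth)
  moreover have "(j + 2 + (N - j) - 1) choose (N - j) = Suc N choose Suc j" if "j \<le> N"
    using that binomial_symmetric[of "N - j" "Suc N"] by (simp add: Suc_diff_le)
  ultimately show ?thesis by simp
qed

text \<open>
  The coefficient of \<open>v\<^sup>N\<close> in the additive difference equation. The summand \<open>j = N\<close> of the shifted
  series cancels against the unshifted one, so the equation determines the coefficient of index
  \<open>N - 1\<close> from the earlier ones.
\<close>

lemma log_deriv_recurrence:
  "(\<Sum>j<N. fps_nth log_deriv j * (of_nat (Suc N choose Suc j) * 4 ^ (N - j)))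
     = 6 * 3 ^ N - 2 * 2 ^ N - 4 * 4 ^ N"
proof -
  have compose_nth: "fps_nth (log_deriv oo shift4) i = fps_nth (\<Sum>j\<le>N. fps_const (fps_nth log_deriv j) * shift4 ^ j) i"
    if "i \<le> N" for i
  proof -
    have "fps_nth (shift4 ^ j) i = 0" if "i < j" for j
      using that by (rule startsby_zero_power_prefix[OF shift4_0, rule_format])
    then have "(\<Sum>j=0..i. fps_nth log_deriv j * fps_nth (shift4 ^ j) i)
        = (\<Sum>j\<le>N. fps_nth log_deriv j * fps_nth (shift4 ^ j) i)"
      using that by (intro sum.mono_neutral_left) auto
    then show ?thesis by (simp add: fps_compose_nth fps_sum_nth)
  qed
  have "fps_nth ((log_deriv oo shift4) * fps_deriv shift4) N
      = fps_nth ((\<Sum>j\<le>N. fps_const (fps_nth log_deriv j) * shift4 ^ j) * fps_deriv shift4) N"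
    unfolding fps_mult_nth by (intro sum.cong refl arg_cong2[where f = times] compose_nth) auto
  also have "\<dots> = (\<Sum>j\<le>N. fps_nth log_deriv j * fps_nth (shift4 ^ j * fps_deriv shift4) N)"
    by (simp add: sum_distrib_right mult.assoc fps_sum_nth)
  also have "\<dots> = (\<Sum>j\<le>N. fps_nth log_deriv j * (of_nat (Suc N choose Suc j) * 4 ^ (N - j)))"
    by (intro sum.cong refl) (simp add: shift4_power_deriv_nth)
  also have "\<dots> = (\<Sum>j<N. fps_nth log_deriv j * (of_nat (Suc N choose Suc j) * 4 ^ (N - j))) + fps_nth log_deriv N"
    by (subst lessThan_Suc_atMost[symmetric], subst sum.lessThan_Suc) simp
  finally have "(\<Sum>j<N. fps_nth log_deriv j * (of_nat (Suc N choose Suc j) * 4 ^ (N - j)))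
      = fps_nth ((log_deriv oo shift4) * fps_deriv shift4 - log_deriv) N"
    by simp
  moreover have "fps_nth (inverse (1 - fps_const a * fps_X)) N = a ^ N" for a :: complex
    using one_minus_const_fps_X_neg_power'[of 1 a] by (cases "a = 0") auto
  ultimately show ?thesis
    unfolding log_deriv_shift4 by simp
qed

section \<open>2-integral numbers and 2-adic units\<close>

text \<open>
  The localization of the integers at the prime 2 and its group of units, as subsets of the complex
  numbers because that is the type of the coefficients of \<open>Den\<close>.
\<close>

definition two_integral :: "complex set" where
  "two_integral = {x. \<exists>a b :: int. odd b \<and> of_int b * x = of_int a}"

definition two_unit :: "complex set" where
  "two_unit = {x. \<exists>a b :: int. odd a \<and> odd b \<and> of_int b * x = of_int a}"

lemma two_integralI: "odd b \<Longrightarrow> of_int b * x = of_int a \<Longrightarrow> x \<in> two_integral"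
  unfolding two_integral_def by blast

lemma two_integral_of_int: "of_int a \<in> two_integral"
  by (rule two_integralI[of 1]) auto

lemma two_integral_of_nat: "of_nat a \<in> two_integral"
  using two_integral_of_int[of "int a"] by simp

lemma two_integral_add:
  assumes "x \<in> two_integral" "y \<in> two_integral"
  shows "x + y \<in> two_integral"
proof -
  obtain a b a' b' :: int where *: "odd b" "of_int b * x = of_int a" "odd b'" "of_int b' * y = of_int a'"
    using assms unfolding two_integral_def by blast
  have "of_int (b * b') * (x + y) = of_int b' * (of_int b * x) + of_int b * (of_int b' * y)"
    by (simp add: algebra_simps)
  also have "\<dots> = of_int (b' * a + b * a')"
    by (simp add: *)
  finally show ?thesis
    by (rule two_integralI[rotated]) (use * in simp)
qed

lemma two_integral_mult:
  assumes "x \<in> two_integral" "y \<in> two_integral"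
  shows "x * y \<in> two_integral"
proof -
  obtain a b a' b' :: int where *: "odd b" "of_int b * x = of_int a" "odd b'" "of_int b' * y = of_int a'"
    using assms unfolding two_integral_def by blast
  have "of_int (b * b') * (x * y) = (of_int b * x) * (of_int b' * y)"
    by (simp add: algebra_simps)
  also have "\<dots> = of_int (a * a')"
    by (simp add: *)
  finally show ?thesis
    by (rule two_integralI[rotated]) (use * in simp)
qed

lemma two_integral_minus: "x \<in> two_integral \<Longrightarrow> - x \<in> two_integral"
  using two_integral_mult[OF two_integral_of_int[of "-1"]] by simp

lemma two_integral_diff:
  "x \<in> two_integral \<Longrightarrow> y \<in> two_integral \<Longrightarrow> x - y \<in> two_integral"
  using two_integral_add[OF _ two_integral_minus] by simp

lemma two_integral_sum: "(\<And>i. i \<in> A \<Longrightarrow> f i \<in> two_integral) \<Longrightarrow> sum f A \<in> two_integral"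
  by (induction A rule: infinite_finite_induct)
     (auto intro: two_integral_add two_integral_of_nat[of 0, simplified])

lemma two_integral_double: "x / 2 \<in> two_integral \<Longrightarrow> x \<in> two_integral"
  using two_integral_mult[OF two_integral_of_int[of 2], of "x / 2"] by simp

lemma two_unit_imp_integral: "x \<in> two_unit \<Longrightarrow> x \<in> two_integral"
  unfolding two_unit_def two_integral_def by blast

lemma two_unit_minus: "x \<in> two_unit \<Longrightarrow> - x \<in> two_unit"
  unfolding two_unit_def by clarsimp (metis even_minus mult_minus_right of_int_minus)

lemma two_unit_add_even:
  assumes "x \<in> two_unit" "y / 2 \<in> two_integral"
  shows "x + y \<in> two_unit"
proof -
  obtain a b a' b' :: int
    where *: "odd a" "odd b" "of_int b * x = of_int a" "odd b'" "of_int b' * (y / 2) = of_int a'"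
    using assms unfolding two_integral_def two_unit_def by blast
  have "of_int (b * b') * (x + y) = of_int b' * (of_int b * x) + 2 * of_int b * (of_int b' * (y / 2))"
    by (simp add: algebra_simps)
  also have "\<dots> = of_int (b' * a + 2 * b * a')"
    by (simp only: *) simp
  finally show ?thesis
    unfolding two_unit_def using * by (intro CollectI exI[of _ "b' * a + 2 * b * a'"] exI[of _ "b * b'"]) auto
qed

text \<open>
  The power of 2 in \<open>N + 2\<close> is at most \<open>N + 2 \<le> 4\<^sup>N\<close>; for \<open>N = 0\<close> the quotient is \<open>1/2\<close>.
\<close>

lemma four_power_div_two_integral:
  assumes "N \<ge> 1"
  shows "4 ^ N / of_nat (N + 2) \<in> two_integral"
proof -
  obtain o' where o': "N + 2 = 2 ^ multiplicity 2 (N + 2) * o'" "odd o'"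
    using multiplicity_decompose'[of "N + 2" "2::nat"] by auto
  define e where "e = multiplicity 2 (N + 2)"
  have "N + 2 \<le> 4 ^ N"
    using assms by (induction N rule: dec_induct) auto
  moreover have "2 ^ e \<le> N + 2"
    using multiplicity_dvd[of 2 "N + 2"] by (intro dvd_imp_le) (auto simp: e_def)
  ultimately have "(2::nat) ^ e \<le> 2 ^ (2 * N)"
    by (simp add: power_mult)
  then have "e \<le> 2 * N"
    by simp
  then have "(4::complex) ^ N = 2 ^ e * 2 ^ (2 * N - e)"
    by (simp add: power_mult flip: power_add)
  moreover have "of_nat (N + 2) = (2 ^ e * of_nat o' :: complex)"
    by (subst o'(1)) (simp add: e_def)
  moreover have "o' \<noteq> 0" using o'(2) by (intro notI) simp
  ultimately have "of_int (int o') * (4 ^ N / of_nat (N + 2) :: complex) = of_int (2 ^ (2 * N - e))"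
    by simp
  then show ?thesis
    by (rule two_integralI[rotated]) (use o' in simp)
qed

section \<open>Parity of the normalized coefficients\<close>

text \<open>
  If \<open>Den\<close> is read as the moment generating function \<open>\<Sum> e\<^sub>n t\<^sup>n / n!\<close> with \<open>t = v/4\<close>, then
  \<open>cumulant n\<close> is its cumulant of index \<open>n + 1\<close>, that is, the coefficient of \<open>t\<^sup>n\<^sup>+\<^sup>1/(n + 1)!\<close> in
  \<open>log Den\<close>.
\<close>

definition cumulant :: "nat \<Rightarrow> complex" where
  "cumulant n = 4 ^ Suc n * fact n * fps_nth log_deriv n"

text \<open>
  The recurrence of the logarithmic derivative, divided by its leading coefficient \<open>4 (N + 2)\<close>.
  By the absorption identity
  \<open>(N + 2 choose j + 1) / (N + 2) = (N + 1 choose j) / (j + 1)\<close> this division disappears from the sum,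
  whose coefficients are integers divisible by 16; it stays only in the inhomogeneous term.
\<close>

lemma cumulant_recurrence:
  "cumulant N = fact N * (6 * 3 ^ Suc N - 2 * 2 ^ Suc N - 4 * 4 ^ Suc N) * (4 ^ N / of_nat (N + 2))
     - (\<Sum>j<N. 16 ^ (N - j) * of_nat (fact N div fact (Suc j)) * of_nat (Suc N choose j) * cumulant j)"
proof -
  define R :: complex where "R = 6 * 3 ^ Suc N - 2 * 2 ^ Suc N - 4 * 4 ^ Suc N"
  define K :: complex where "K = 4 ^ N * fact N / of_nat (N + 2)"
  have summand: "K * (fps_nth log_deriv j * (of_nat (Suc (Suc N) choose Suc j) * 4 ^ (Suc N - j)))
      = 16 ^ (N - j) * of_nat (fact N div fact (Suc j)) * of_nat (Suc N choose j) * cumulant j"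
    if "j < N" for j
  proof -
    obtain i where N: "N = Suc j + i"
      using \<open>j < N\<close> less_iff_Suc_add by auto
    have "of_nat (Suc j * (Suc (Suc N) choose Suc j)) = (of_nat (Suc (Suc N) * (Suc N choose j)) :: complex)"
      by (simp only: Suc_times_binomial)
    then have "of_nat (Suc j) * of_nat (Suc (Suc N) choose Suc j)
        = (of_nat (N + 2) * of_nat (Suc N choose j) :: complex)"
      by (simp only: of_nat_mult add_2_eq_Suc')
    then have "of_nat (Suc (Suc N) choose Suc j) / of_nat (N + 2) = (of_nat (Suc N choose j) / of_nat (Suc j) :: complex)"
      by (simp add: frac_eq_eq mult.commute del: of_nat_Suc binomial_Suc_Suc)
    moreover have "of_nat (fact N div fact (Suc j)) = (fact N / (of_nat (Suc j) * fact j) :: complex)"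
    proof -
      have "fact N div fact (Suc j) * fact (Suc j) = (fact N :: nat)"
        using \<open>j < N\<close> by (intro dvd_div_mult_self fact_dvd) simp
      then have "of_nat (fact N div fact (Suc j)) * (of_nat (Suc j) * fact j) = (fact N :: complex)"
        by (metis fact_Suc of_nat_fact of_nat_mult)
      then show ?thesis
        by (simp add: eq_divide_eq del: of_nat_Suc fact_Suc)
    qed
    moreover have "(16::complex) ^ (N - j) * 4 ^ Suc j = 4 ^ N * 4 ^ (Suc N - j)"
    proof -
      have "(16::complex) = 4 ^ 2" by simp
      then have "(16::complex) ^ (N - j) * 4 ^ Suc j = 4 ^ (2 * (N - j) + Suc j)"
        by (simp only: power_mult power_add)
      also have "2 * (N - j) + Suc j = N + (Suc N - j)"
        using \<open>j < N\<close> by simp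
      finally show ?thesis by (simp only: power_add)
    qed
    moreover have "K * (m * (b * q)) = x * D * B * (4 ^ Suc j * fact j * m)"
      if "b / of_nat (N + 2) = B / of_nat (Suc j)" "D = fact N / (of_nat (Suc j) * fact j)"
        "x * 4 ^ Suc j = 4 ^ N * q" for m b q x D B
    proof -
      have "K * (m * (b * q)) = (4 ^ N * q) * fact N * m * (b / of_nat (N + 2))"
        by (simp add: K_def)
      also have "\<dots> = (x * 4 ^ Suc j) * fact N * m * (B / of_nat (Suc j))"
        by (simp only: that)
      also have "\<dots> = x * D * B * (4 ^ Suc j * fact j * m)"
        unfolding that(2) by (simp del: of_nat_Suc power_Suc)
      finally show ?thesis .
    qed
    ultimately show ?thesis
      unfolding cumulant_def by blast
  qed
  have "(\<Sum>j<Suc N. fps_nth log_deriv j * (of_nat (Suc (Suc N) choose Suc j) * 4 ^ (Suc N - j))) = R"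
    unfolding R_def by (rule log_deriv_recurrence)
  then have "K * R = (\<Sum>j<N. K * (fps_nth log_deriv j * (of_nat (Suc (Suc N) choose Suc j) * 4 ^ (Suc N - j))))
      + K * (fps_nth log_deriv N * (of_nat (N + 2) * 4))"
    by (simp add: sum_distrib_left distrib_left flip: \<open>_ = R\<close> del: binomial_Suc_Suc)
  also have "K * (fps_nth log_deriv N * (of_nat (N + 2) * 4)) = cumulant N"
    by (simp add: K_def cumulant_def del: of_nat_Suc of_nat_add)
  also have "(\<Sum>j<N. K * (fps_nth log_deriv j * (of_nat (Suc (Suc N) choose Suc j) * 4 ^ (Suc N - j))))
      = (\<Sum>j<N. 16 ^ (N - j) * of_nat (fact N div fact (Suc j)) * of_nat (Suc N choose j) * cumulant j)"
    by (intro sum.cong refl summand) auto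
  finally show ?thesis
    by (simp add: K_def R_def algebra_simps)
qed

lemma cumulant_0: "cumulant 0 = -1"
  by (subst cumulant_recurrence) simp

text \<open>
  In the recurrence the sum is even because of the factors 16. The inhomogeneous term is even because
  \<open>6 \<cdot> 3\<^sup>N\<^sup>+\<^sup>1 - 2 \<cdot> 2\<^sup>N\<^sup>+\<^sup>1 - 4 \<cdot> 4\<^sup>N\<^sup>+\<^sup>1\<close> is, and \<open>4\<^sup>N\<close> absorbs the denominator \<open>N + 2\<close> as soon as
  \<open>N \<ge> 1\<close>.
\<close>

lemma cumulant_even: "N \<ge> 1 \<Longrightarrow> cumulant N / 2 \<in> two_integral"
proof (induction N rule: less_induct)
  case (less N)
  have integral: "cumulant j \<in> two_integral" if "j < N" for j
  proof (cases "j = 0")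
    case True
    then show ?thesis using two_integral_of_int[of "-1"] by (simp add: cumulant_0)
  qed (use less.IH that in \<open>auto intro: two_integral_double\<close>)
  have sum_term: "16 ^ (N - j) * of_nat (fact N div fact (Suc j)) * of_nat (Suc N choose j) * cumulant j / 2 \<in> two_integral"
    if "j < N" for j
  proof -
    have "16 ^ (N - j) * of_nat (fact N div fact (Suc j)) * of_nat (Suc N choose j) * cumulant j / 2
        = of_nat (8 * 16 ^ (N - Suc j) * (fact N div fact (Suc j)) * (Suc N choose j)) * cumulant j"
    proof -
      have "(16::complex) ^ (N - j) = 2 * (8 * 16 ^ (N - Suc j))"
        using that by (simp flip: Suc_diff_Suc)
      then show ?thesis by (simp only:) simp
    qed
    then show ?thesis
      by (simp only: two_integral_mult[OF two_integral_of_nat integral[OF that]])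
  qed
  have split: "(F * R * q - S) / 2 = F * (R / 2) * q - S / 2" for F R q S :: complex
    by (simp add: diff_divide_distrib)
  have "cumulant N / 2 = of_int (fact N * (3 * 3 ^ Suc N - 2 ^ Suc N - 2 * 4 ^ Suc N)) * (4 ^ N / of_nat (N + 2))
     - (\<Sum>j<N. 16 ^ (N - j) * of_nat (fact N div fact (Suc j)) * of_nat (Suc N choose j) * cumulant j / 2)"
    unfolding cumulant_recurrence[of N] split sum_divide_distrib[symmetric]
    by (simp add: diff_divide_distrib del: power_Suc)
  also have "\<dots> \<in> two_integral"
    by (intro two_integral_diff two_integral_mult two_integral_of_int two_integral_sum sum_term
          four_power_div_two_integral less.prems) auto
  finally show ?case .
qed

lemma d_recurrence:
  assumes "s \<in> {1, -1}"
  shows "of_nat (Suc n) * d s (Suc n) = of_int s * (\<Sum>i\<le>n. fps_nth log_deriv i * d s (n - i))"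
proof -
  have "of_nat (Suc n) * d s (Suc n) = fps_nth (fps_deriv (Den powi s)) n"
    by (simp add: d_def)
  also have "\<dots> = fps_nth (fps_const (of_int s) * (log_deriv * Den powi s)) n"
    by (simp add: deriv_Den_powi[OF assms] mult.assoc fps_of_int)
  also have "\<dots> = of_int s * fps_nth (log_deriv * Den powi s) n"
    by (rule fps_mult_left_const_nth)
  finally show ?thesis
    by (simp only: d_def fps_mult_nth atLeast0AtMost)
qed

definition moment :: "int \<Rightarrow> nat \<Rightarrow> complex" where
  "moment s n = 4 ^ n * fact n * d s n"

lemma moment_0: "s \<in> {1, -1} \<Longrightarrow> moment s 0 = 1"
  by (auto simp: moment_def d_def Den_nth_0)

lemma moment_recurrence:
  assumes "s \<in> {1, -1}"
  shows "moment s (Suc n) = of_int s * (\<Sum>i\<le>n. of_nat (n choose i) * cumulant i * moment s (n - i))"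
proof -
  have "moment s (Suc n) = 4 ^ Suc n * fact n * (of_nat (Suc n) * d s (Suc n))"
    by (simp add: moment_def)
  also have "\<dots> = of_int s * (\<Sum>i\<le>n. 4 ^ Suc n * fact n * (fps_nth log_deriv i * d s (n - i)))"
    unfolding d_recurrence[OF assms] by (simp add: sum_distrib_left mult_ac)
  also have "(\<Sum>i\<le>n. 4 ^ Suc n * fact n * (fps_nth log_deriv i * d s (n - i)))
      = (\<Sum>i\<le>n. of_nat (n choose i) * cumulant i * moment s (n - i))"
  proof (intro sum.cong refl)
    fix i assume "i \<in> {..n}"
    then have i: "i \<le> n" by simp
    then have "(4::complex) ^ Suc n = 4 ^ Suc i * 4 ^ (n - i)"
      by (simp flip: power_add)
    with i show "4 ^ Suc n * fact n * (fps_nth log_deriv i * d s (n - i))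
        = of_nat (n choose i) * cumulant i * moment s (n - i)"
      by (simp add: moment_def cumulant_def binomial_fact)
  qed
  finally show ?thesis .
qed

text \<open>
  Modulo 2 only the summand \<open>i = 0\<close> of \<open>moment_recurrence\<close> survives, and it is \<open>\<plusminus> moment s m\<close>.
\<close>

lemma moment_unit:
  assumes "s \<in> {1, -1}"
  shows "moment s n \<in> two_unit"
proof (induction n rule: less_induct)
  case (less n)
  show ?case
  proof (cases n)
    case 0
    then show ?thesis
      unfolding two_unit_def by (simp add: moment_0[OF assms]) (metis odd_one of_int_1)
  next
    case (Suc m)
    let ?f = "\<lambda>i. of_nat (m choose i) * cumulant i * moment s (m - i)"
    have "moment s n = of_int s * (?f 0 + (\<Sum>i<m. ?f (Suc i)))"
      by (simp only: Suc moment_recurrence[OF assms] sum.atMost_shift)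
    also have "\<dots> = - of_int s * moment s m + of_int s * (\<Sum>i<m. ?f (Suc i))"
      by (simp add: cumulant_0 algebra_simps)
    also have "\<dots> \<in> two_unit"
    proof (rule two_unit_add_even)
      show "- of_int s * moment s m \<in> two_unit"
        using assms less.IH[of m] Suc by (auto intro: two_unit_minus)
      have "?f (Suc i) / 2 \<in> two_integral" if "i < m" for i
      proof -
        have "moment s (m - Suc i) \<in> two_unit"
          using less.IH Suc by simp
        then have "of_nat (m choose Suc i) * moment s (m - Suc i) * (cumulant (Suc i) / 2) \<in> two_integral"
          by (intro two_integral_mult two_integral_of_nat cumulant_even two_unit_imp_integral) auto
        then show ?thesis by (simp add: mult_ac)
      qed
      then have "of_int s * (\<Sum>i<m. ?f (Suc i) / 2) \<in> two_integral"
        by (intro two_integral_mult two_integral_of_int two_integral_sum) auto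
      then show "of_int s * (\<Sum>i<m. ?f (Suc i)) / 2 \<in> two_integral"
        by (simp only: sum_divide_distrib[symmetric] times_divide_eq_right)
    qed
    finally show ?thesis .
  qed
qed

section \<open>Valuations of the coefficients\<close>

lemma \<nu>\<^sub>2_of_int_div:
  assumes "a \<noteq> 0" "b \<noteq> 0"
  shows "\<nu>\<^sub>2 (of_int a / of_int b) = int (multiplicity 2 a) - int (multiplicity 2 b)"
proof -
  obtain p q where pq: "quotient_of (of_int a / of_int b) = (p, q)"
    by (cases "quotient_of (of_int a / of_int b)")
  have "q \<noteq> 0" using quotient_of_denom_pos[OF pq] by simp
  have "of_int a / of_int b = (of_int p / of_int q :: rat)"
    by (rule quotient_of_div[OF pq])
  then have "(of_int (a * q) :: rat) = of_int (p * b)"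
    using assms \<open>q \<noteq> 0\<close> by (simp add: field_simps)
  then have eq: "a * q = p * b"
    by (simp only: of_int_eq_iff)
  moreover from this have "p \<noteq> 0" using assms \<open>q \<noteq> 0\<close> by auto
  moreover have "prime_elem (2::int)" by simp
  ultimately have "multiplicity 2 a + multiplicity 2 q = multiplicity 2 p + multiplicity 2 b"
    using assms \<open>q \<noteq> 0\<close> by (metis prime_elem_multiplicity_mult_distrib)
  then show ?thesis
    by (simp add: \<nu>\<^sub>2_def pq)
qed

lemma \<nu>\<^sub>2_d:
  assumes "s \<in> {1, -1}"
  shows "\<exists>r. d s n = of_rat r \<and> \<nu>\<^sub>2 r = - (2 * int n + int (multiplicity 2 (fact n :: int)))"
proof -
  obtain a b :: int where ab: "odd a" "odd b" "of_int b * moment s n = of_int a"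
    using moment_unit[OF assms, of n] unfolding two_unit_def by blast
  have nz: "a \<noteq> 0" "b \<noteq> 0" using ab by auto
  have prime: "prime_elem (2::int)" by simp
  define c :: int where "c = b * (2 ^ (2 * n) * fact n)"
  have "c \<noteq> 0" using nz by (simp add: c_def)
  have "of_int c * d s n = of_int b * moment s n"
    by (simp add: c_def moment_def power_mult)
  then have "d s n = of_rat (of_int a / of_int c)"
    using \<open>c \<noteq> 0\<close> ab(3) by (simp add: of_rat_divide field_simps)
  moreover have "multiplicity 2 c = 2 * n + multiplicity 2 (fact n :: int)"
    using ab(2) nz unfolding c_def
    by (simp add: prime_elem_multiplicity_mult_distrib[OF prime] not_dvd_imp_multiplicity_0)
  then have "\<nu>\<^sub>2 (of_int a / of_int c) = - (2 * int n + int (multiplicity 2 (fact n :: int)))"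
    using ab(1) by (simp add: \<nu>\<^sub>2_of_int_div[OF nz(1) \<open>c \<noteq> 0\<close>] not_dvd_imp_multiplicity_0)
  ultimately show ?thesis by blast
qed

lemma multiplicity_2_fact_odd: "multiplicity 2 (fact (2 * k + 1) :: int) = multiplicity 2 (fact (2 * k) :: int)"
proof -
  have "(fact (2 * k + 1) :: int) = (2 * int k + 1) * fact (2 * k)" by simp
  then show ?thesis
    by (simp only:) (subst prime_elem_multiplicity_mult_distrib, simp_all add: not_dvd_imp_multiplicity_0)
qed

text \<open>
  Legendre's formula in recursive form: the even factors of \<open>(2k)!\<close> multiply to \<open>2\<^sup>k k!\<close>.
\<close>

lemma multiplicity_2_fact_even: "multiplicity 2 (fact (2 * k) :: int) = k + multiplicity 2 (fact k :: int)"
proof (induction k)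
  case (Suc k)
  have prime: "prime_elem (2::int)" by simp
  have "(fact (2 * Suc k) :: int) = 2 * (int (Suc k) * fact (2 * k + 1))"
    by (simp add: algebra_simps)
  then have "multiplicity 2 (fact (2 * Suc k) :: int) = 1 + multiplicity 2 (int (Suc k)) + multiplicity 2 (fact (2 * k) :: int)"
    by (simp only: multiplicity_2_fact_odd[symmetric])
       (simp add: prime_elem_multiplicity_mult_distrib[OF prime] del: of_nat_Suc fact_Suc)
  also have "\<dots> = Suc k + multiplicity 2 (int (Suc k) * fact k)"
    by (simp add: Suc.IH prime_elem_multiplicity_mult_distrib[OF prime] del: of_nat_Suc)
  finally show ?case by simp
qed simp

theorem theorem10p3:
  fixes s :: int
  assumes "s \<in> {1, -1}"
  shows "(\<forall>k::nat. k \<ge> 1 \<longrightarrow>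
            (\<exists>r::rat. d s (2 * k) = of_rat r \<and>
               \<nu>\<^sub>2 r = - (5 * int k + \<nu>\<^sub>2 (fact k)))) \<and>
         (\<forall>k::nat.
            (\<exists>r::rat. d s (2 * k + 1) = of_rat r \<and>
               \<nu>\<^sub>2 r = - (5 * int k + 2 + \<nu>\<^sub>2 (fact k))))"
proof -
  have fact: "\<nu>\<^sub>2 (fact k) = int (multiplicity 2 (fact k :: int))" for k
    using \<nu>\<^sub>2_of_int_div[of "fact k" 1] by simp
  have even: "- (2 * int (2 * k) + int (multiplicity 2 (fact (2 * k) :: int)))
      = - (5 * int k + \<nu>\<^sub>2 (fact k))" for k
    by (simp add: fact multiplicity_2_fact_even)
  have odd: "- (2 * int (2 * k + 1) + int (multiplicity 2 (fact (2 * k + 1) :: int)))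
      = - (5 * int k + 2 + \<nu>\<^sub>2 (fact k))" for k
    unfolding multiplicity_2_fact_odd by (simp add: fact multiplicity_2_fact_even)
  show ?thesis
    using \<nu>\<^sub>2_d[OF assms, of "2 * _", unfolded even] \<nu>\<^sub>2_d[OF assms, of "2 * _ + 1", unfolded odd]
    by blast
qed

end
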